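(* For every real $x$ with $0 < x < 1$, $$2\left(\frac{\arcsin x}{x}\right) + \frac{\arctan x}{x} < 3 + \frac{5\pi-12}{\pi}\, x^3 \arctan x,$$ and the constant $\frac{5\pi-12}{\pi}$ is the best possible, i.e. it is the smallest real number $c$ such that $2\left(\frac{\arcsin x}{x}\right) + \frac{\arctan x}{x} < 3 + c\, x^3 \arctan x$ holds for all $x \in (0,1)$.
   Context: Here $\arcsin$ and $\arctan$ are the usual real principal inverse trigonometric functions. *)

theory Defs
  imports Complex_Main
begin

end

(* With C = (5 pi - 12) / pi, dividing the inequality by x^4 turns it into F(x) < 0 for
     F(x) = (2 arcsin x + arctan x - 3 x) / x^5 - C (arctan x / x).
   Since F(1) = 0, it suffices that F increases on (0, 1].  The numerator x^6 F'(x) is positive: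
   it splits into an arcsin part, whose own derivative is, with s = sqrt (1 - x^2), the nonnegative
   quantity (1 - s)^3 (1 + 3 s + s^2) / s^3, and an arctan part, which is bounded below
   through the Taylor polynomial of degree 9 of arctan.  Equality at x = 1 makes C optimal. *)

theory Submission
  imports Defs
begin

text \<open>Truncating the geometric series of \<open>1 / (1 + y^2)\<close> leaves a remainder of
  known sign, here \<open>y^4 / (1 + y^2)\<close>; for the degree 9 bound it is
  \<open>y^10 / (1 + y^2)\<close>.\<close>

lemma arctan_lower_bound_cubic:
  fixes x :: real
  assumes "0 \<le> x"
  shows "x - x ^ 3 / 3 \<le> arctan x"
proof -
  let ?f = "\<lambda>x::real. arctan x - (x - x ^ 3 / 3)"
  have "?f 0 \<le> ?f x"
  proof (rule DERIV_nonneg_imp_nondecreasing[OF assms])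
    fix y :: real
    have pos: "1 + y ^ 2 > 0"
      by (simp add: add_pos_nonneg)
    have deriv: "(?f has_real_derivative (inverse (1 + y ^ 2) - (1 - y ^ 2))) (at y)"
      by (auto intro!: derivative_eq_intros)
    have "inverse (1 + y ^ 2) - (1 - y ^ 2) = y ^ 4 / (1 + y ^ 2)"
      using pos by (simp add: field_simps eval_nat_numeral)
    also have "\<dots> \<ge> 0"
      using pos by simp
    finally show "\<exists>d. (?f has_real_derivative d) (at y) \<and> 0 \<le> d"
      using deriv by blast
  qed
  then show ?thesis by simp
qed

lemma arctan_upper_bound_degree9:
  fixes x :: real
  assumes "0 \<le> x"
  shows "arctan x \<le> x - x ^ 3 / 3 + x ^ 5 / 5 - x ^ 7 / 7 + x ^ 9 / 9"
proof -
  let ?f = "\<lambda>x::real. (x - x ^ 3 / 3 + x ^ 5 / 5 - x ^ 7 / 7 + x ^ 9 / 9) - arctan x"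
  have "?f 0 \<le> ?f x"
  proof (rule DERIV_nonneg_imp_nondecreasing[OF assms])
    fix y :: real
    let ?d = "1 - y ^ 2 + y ^ 4 - y ^ 6 + y ^ 8 - inverse (1 + y ^ 2)"
    have pos: "1 + y ^ 2 > 0"
      by (simp add: add_pos_nonneg)
    have deriv: "(?f has_real_derivative ?d) (at y)"
      by (auto intro!: derivative_eq_intros)
    have "?d = y ^ 10 / (1 + y ^ 2)"
      using pos by (simp add: field_simps eval_nat_numeral)
    also have "\<dots> \<ge> 0"
      using pos by simp
    finally show "\<exists>d. (?f has_real_derivative d) (at y) \<and> 0 \<le> d"
      using deriv by blast
  qed
  then show ?thesis by simp
qed

text \<open>Serves to give \<open>C \<ge> 11 / 10\<close>, that is pi \<ge> 40/13. The bound pi > 3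
  would only give C > 1, while \<open>B\<close> in \<open>arctan_part_pos\<close> is negative for C
  = t = 1.\<close>

lemma pi_gt_3_14: "pi > 3.14"
proof -
  have "arctan (1 / 5) \<ge> 1 / 5 - (1 / 5) ^ 3 / 3"
    by (rule arctan_lower_bound_cubic) simp
  moreover have "arctan (1 / 239) \<le> 1 / 239"
    using arctan_upper_bound_degree9[of "1 / 239"] by (simp add: power_divide)
  moreover have "pi / 4 = 4 * arctan (1 / 5) - arctan (1 / 239)"
    by (rule machin)
  ultimately show ?thesis
    by (simp add: power3_eq_cube)
qed

text \<open>The terms \<open>4 * x\<close> and \<open>x ^ 3 / 3\<close> make the Taylor expansion at
  0 start at degree 7, which is why the derivative has the triple zero at s = 1.\<close>

lemma arcsin_part_nonneg:
  fixes x :: real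
  assumes "0 \<le> x" "x < 1"
  shows "0 \<le> x / sqrt (1 - x ^ 2) + 4 * x + x ^ 3 / 3 - 5 * arcsin x"
proof -
  let ?f = "\<lambda>x::real. x / sqrt (1 - x ^ 2) + 4 * x + x ^ 3 / 3 - 5 * arcsin x"
  have "?f 0 \<le> ?f x"
  proof (rule DERIV_nonneg_imp_nondecreasing[OF assms(1)])
    fix y :: real
    assume y: "0 \<le> y" "y \<le> x"
    define s where "s = sqrt (1 - y ^ 2)"
    have "y ^ 2 < 1"
      using y assms by (simp add: abs_square_less_1)
    then have s: "0 < s" "s \<le> 1" and s2: "y ^ 2 = 1 - s ^ 2"
      unfolding s_def by auto
    let ?d = "(1 * s - y * ((- 2 * y) * (inverse s / 2))) / (s * s) + 4 + y ^ 2 - 5 * inverse s"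
    have deriv: "(?f has_real_derivative ?d) (at y)"
      using \<open>y ^ 2 < 1\<close> y assms s unfolding s_def
      by (auto intro!: derivative_eq_intros)
    have "?d = (1 - s) ^ 3 * (1 + 3 * s + s ^ 2) / s ^ 3"
    proof -
      have "?d = (s ^ 2 + y ^ 2) / s ^ 3 + 4 + y ^ 2 - 5 / s"
        using s by (simp add: field_simps eval_nat_numeral)
      also have "\<dots> = 1 / s ^ 3 + 5 - s ^ 2 - 5 / s"
        using s2 by simp
      also have "\<dots> = (1 - s) ^ 3 * (1 + 3 * s + s ^ 2) / s ^ 3"
        using s by (simp add: field_simps eval_nat_numeral)
      finally show ?thesis .
    qed
    also have "\<dots> \<ge> 0"
      using s by simp
    finally show "\<exists>d. (?f has_real_derivative d) (at y) \<and> 0 \<le> d"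
      using deriv by blast
  qed
  then show ?thesis by simp
qed

lemma arctan_part_pos:
  fixes x C :: real
  assumes x: "0 < x" "x < 1" and C: "11 / 10 \<le> C" "C \<le> 5"
  shows "0 < 4 * x - 2 / 3 * x ^ 3 - (5 - C * x ^ 4) * arctan x + (x - C * x ^ 5) / (1 + x ^ 2)"
proof -
  define t where "t = x ^ 2"
  have t: "0 < t" "t < 1"
    using x by (auto simp: t_def abs_square_less_1)
  define K where "K = 2 / 3 - 2 / 15 * t + 2 / 35 * t ^ 2 - 2 / 63 * t ^ 3 + t ^ 4 / 9"
  define B where "B = 10 / 63 * t - 5 / 9 * t ^ 2 - 2 / 7 + C * K"
  have "t ^ 2 \<le> t" "t ^ 3 \<le> t ^ 2"
    using t power_decreasing[of 1 2 t] power_decreasing[of 2 3 t] by auto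
  \<comment> \<open>A tangent bound that, with \<open>t ^ 3 \<le> t ^ 2\<close>, makes the estimate
    of \<open>K\<close> quadratic, hence linear in the atoms \<open>t\<close> and
    \<open>t ^ 2\<close>.\<close>
  have "t ^ 4 \<ge> t ^ 2 - 1 / 4"
    using zero_le_power2[of "t ^ 2 - 1 / 2"] by (simp add: power2_diff power_divide)
  have K_lower: "K \<ge> 23 / 36 - 2 / 15 * t + 43 / 315 * t ^ 2"
    using \<open>t ^ 3 \<le> t ^ 2\<close> \<open>t ^ 4 \<ge> t ^ 2 - 1 / 4\<close>
    unfolding K_def by linarith
  have "0 \<le> 23 / 36 - 2 / 15 * t + 43 / 315 * t ^ 2"
    using t zero_le_power2[of t] by linarith
  then have "11 / 10 * (23 / 36 - 2 / 15 * t + 43 / 315 * t ^ 2) \<le> C * K"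
    using K_lower C by (intro mult_mono) auto
  then have "253 / 360 - 11 / 75 * t + 473 / 3150 * t ^ 2 \<le> C * K"
    by (simp add: algebra_simps)
  then have B: "B > 0"
    using t \<open>t ^ 2 \<le> t\<close> unfolding B_def by linarith
  \<comment> \<open>The factor of arctan is thus nonnegative, so replacing arctan by its upper bound
    lowers the whole expression.\<close>
  have "C * x ^ 4 \<le> 5 * 1"
    using x C by (intro mult_mono) (auto intro: power_le_one)
  then have "(5 - C * x ^ 4) * arctan x
      \<le> (5 - C * x ^ 4) * (x - x ^ 3 / 3 + x ^ 5 / 5 - x ^ 7 / 7 + x ^ 9 / 9)"
    using x by (intro mult_left_mono arctan_upper_bound_degree9) auto
  \<comment> \<open>All powers below \<open>x ^ 7\<close> cancel once the denominator is cleared;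
    \<open>B\<close> is the cofactor, a polynomial in t = x^2.\<close>
  moreover have "4 * x - 2 / 3 * x ^ 3
      - (5 - C * x ^ 4) * (x - x ^ 3 / 3 + x ^ 5 / 5 - x ^ 7 / 7 + x ^ 9 / 9)
      + (x - C * x ^ 5) / (1 + x ^ 2) = x ^ 7 * B / (1 + x ^ 2)"
  proof -
    have "1 + x ^ 2 \<noteq> 0"
      using t unfolding t_def by linarith
    moreover have "(4 * x - 2 / 3 * x ^ 3
      - (5 - C * x ^ 4) * (x - x ^ 3 / 3 + x ^ 5 / 5 - x ^ 7 / 7 + x ^ 9 / 9)) * (1 + x ^ 2)
      + (x - C * x ^ 5) = x ^ 7 * B"
      unfolding B_def K_def t_def by (simp add: field_simps eval_nat_numeral)
    ultimately show ?thesis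
      by (simp add: add_divide_eq_iff)
  qed
  moreover have "x ^ 7 * B / (1 + x ^ 2) > 0"
    using x B by (simp add: add_pos_nonneg)
  ultimately show ?thesis
    by linarith
qed

text \<open>The right-hand side is F(1), from arcsin 1 = pi/2 and arctan 1 = pi/4.\<close>

lemma arcsin_arctan_quotient_less:
  fixes x C :: real
  assumes x: "0 < x" "x < 1" and C: "11 / 10 \<le> C" "C \<le> 5"
  shows "(2 * arcsin x + arctan x - 3 * x) / x ^ 5 - C * (arctan x / x)
       < pi + pi / 4 - 3 - C * (pi / 4)"
proof -
  let ?F = "\<lambda>x. (2 * arcsin x + arctan x - 3 * x) / x ^ 5 - C * (arctan x / x)"
  have "?F x < ?F 1"
  \<comment> \<open>arcsin is not differentiable at 1, so the endpoint is reached by continuity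
    alone.\<close>
  proof (rule DERIV_pos_imp_increasing_open[OF x(2)])
    fix y :: real
    assume "x < y" "y < 1"
    then have y: "0 < y" "y < 1"
      using x by auto
    define s where "s = sqrt (1 - y ^ 2)"
    define q where "q = 1 + y ^ 2"
    define d where "d = ((2 * inverse s + inverse q - 3) * y ^ 5
        - (2 * arcsin y + arctan y - 3 * y) * (5 * y ^ 4)) / (y ^ 5 * y ^ 5)
        - C * ((inverse q * y - arctan y) / (y * y))"
    have deriv: "(?F has_real_derivative d) (at y)"
      unfolding d_def s_def q_def using y
      by (auto intro!: derivative_eq_intros simp: right_diff_distrib mult_ac)
    \<comment> \<open>Stated for arbitrary \<open>a\<close> and \<open>b\<close>, so that the
      transcendental terms stay opaque to simplification.\<close>
    have "y ^ 6 * ((a * y ^ 5 - b * (5 * y ^ 4)) / (y ^ 5 * y ^ 5)) = a * y - 5 * b" for a b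
      using y by (simp add: field_simps eval_nat_numeral)
    moreover have "y ^ 6 * (C * (a / (y * y))) = C * y ^ 4 * a" for a
      using y by (simp add: eval_nat_numeral)
    ultimately have "y ^ 6 * d = (2 * inverse s + inverse q - 3) * y
        - 5 * (2 * arcsin y + arctan y - 3 * y) - C * y ^ 4 * (inverse q * y - arctan y)"
      unfolding d_def right_diff_distrib[of "y ^ 6"] by metis
    \<comment> \<open>The term 2/3 y^3 is added to the arcsin part and subtracted from the arctan
      part.\<close>
    also have "\<dots> = 2 * (y / s + 4 * y + y ^ 3 / 3 - 5 * arcsin y)
        + (4 * y - 2 / 3 * y ^ 3 - (5 - C * y ^ 4) * arctan y + (y - C * y ^ 5) / q)"
      unfolding divide_inverse[of _ s] divide_inverse[of _ q] by algebra
    also have "\<dots> > 0"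
      using arcsin_part_nonneg[of y] arctan_part_pos[OF y C] y
      unfolding s_def q_def by simp
    finally have "d > 0"
      using y by (simp add: zero_less_mult_iff)
    then show "\<exists>d. (?F has_real_derivative d) (at y) \<and> 0 < d"
      using deriv by blast
  next
    show "continuous_on {x..1} ?F"
      using x by (intro continuous_intros) auto
  qed
  then show ?thesis
    by (simp add: arctan_one)
qed

theorem mainTheorem2:
  shows "(\<forall>x::real. 0 < x \<and> x < 1 \<longrightarrow>
            2 * (arcsin x / x) + arctan x / x < 3 + (5 * pi - 12) / pi * x ^ 3 * arctan x)
       \<and> (\<forall>c::real.
            (\<forall>x::real. 0 < x \<and> x < 1 \<longrightarrow>
               2 * (arcsin x / x) + arctan x / x < 3 + c * x ^ 3 * arctan x)
            \<longrightarrow> (5 * pi - 12) / pi \<le> c)"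
proof (intro conjI allI impI)
  fix x :: real
  assume "0 < x \<and> x < 1"
  then have x: "0 < x" "x < 1"
    by auto
  define C where "C = (5 * pi - 12) / pi"
  have C: "11 / 10 \<le> C" "C \<le> 5"
    using pi_gt_3_14 by (auto simp: C_def field_simps)
  have "pi + pi / 4 - 3 - C * (pi / 4) = 0"
    by (simp add: C_def field_simps)
  then have "(2 * arcsin x + arctan x - 3 * x) / x ^ 5 - C * (arctan x / x) < 0"
    using arcsin_arctan_quotient_less[OF x C] by simp
  then have "x ^ 4 * ((2 * arcsin x + arctan x - 3 * x) / x ^ 5 - C * (arctan x / x)) < 0"
    using x by (simp add: mult_pos_neg)
  also have "x ^ 4 * ((2 * arcsin x + arctan x - 3 * x) / x ^ 5 - C * (arctan x / x))
      = 2 * (arcsin x / x) + arctan x / x - (3 + C * x ^ 3 * arctan x)"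
    using x by (simp add: field_simps eval_nat_numeral)
  finally show "2 * (arcsin x / x) + arctan x / x < 3 + (5 * pi - 12) / pi * x ^ 3 * arctan x"
    unfolding C_def by simp
next
  fix c :: real
  assume c: "\<forall>x::real. 0 < x \<and> x < 1 \<longrightarrow>
      2 * (arcsin x / x) + arctan x / x < 3 + c * x ^ 3 * arctan x"
  \<comment> \<open>In the limit x -> 1 from the left the strict inequality becomes
    \<open>0 \<le> ?G 1\<close>, that is 5 pi/4 \<le> 3 + c pi/4. Starting the interval at 1/2 keeps
    the divisor away from 0.\<close>
  let ?G = "\<lambda>x. 3 + c * x ^ 3 * arctan x - (2 * (arcsin x / x) + arctan x / x)"
  have "continuous_on {1 / 2..1} ?G"
    by (intro continuous_intros) auto
  then have "(?G \<longlongrightarrow> ?G 1) (at 1 within {1 / 2..1})"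
    unfolding continuous_on_def by (rule bspec) simp
  then have lim: "(?G \<longlongrightarrow> ?G 1) (at_left 1)"
    by (simp add: at_within_Icc_at_left)
  have "eventually (\<lambda>x::real. x \<in> {0<..<1}) (at_left 1)"
    by (rule eventually_at_left_real) simp
  then have "eventually (\<lambda>x. 0 \<le> ?G x) (at_left 1)"
    using c by (auto elim!: eventually_mono simp: less_imp_le)
  then have "0 \<le> ?G 1"
    by (intro tendsto_lowerbound[OF lim]) auto
  then show "(5 * pi - 12) / pi \<le> c"
    by (simp add: arctan_one field_simps)
qed

end
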